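(* For every integer $n > 5$ there exists an incomplete pairwise comparison matrix $\mathbf{A}$ of order $n$, with connected associated graph, such that the logarithmic least squares optimal completion of $\mathbf{A}$ and the eigenvalue optimal completion of $\mathbf{A}$ are different.
   Context: Let $\mathbb{R}_+$ denote the set of positive real numbers. An incomplete pairwise comparison matrix of order $n$ is an $n\times n$ array $\mathbf{A}=[a_{ij}]$ with entries $a_{ij}\in\mathbb{R}_+\cup\{\ast\}$ (where $\ast$ indicates a missing entry) such that for all $1\le i,j\le n$: $a_{ij}\in\mathbb{R}_+$ implies $a_{ji}=1/a_{ij}$, and $a_{ij}=\ast$ implies $a_{ji}=\ast$. Diagonal entries are known, so $a_{ii}=1$. The matrix is complete if it has no missing entries. Associated graph: the undirected graph $G=(V,E)$ with $V=\{1,\dots,n\}$ and, for $i\ne j$, $(i,j)\in E$ if and only if $a_{ij}\neq\ast$. Logarithmic least squares optimal completion: let $\mathbf{w}=[w_i]\in\mathbb{R}^n_+$ be an optimal solution of $$\min \sum_{i,j:\, a_{ij}\neq\ast}\left[\log a_{ij}-\log\left(\frac{w_i}{w_j}\right)\right]^2\quad\text{subject to } w_i>0 \text{ for all } i=1,\dots,n.$$ The logarithmic least squares optimal completion of $\mathbf{A}$ is the complete pairwise comparison matrix $\mathbf{B}=[b_{ij}]$ with $b_{ij}=a_{ij}$ if $a_{ij}\neq\ast$ and $b_{ij}=w_i/w_j$ if $a_{ij}=\ast$. Eigenvalue optimal completion: let $m$ be the number of missing comparisons (unordered pairs $\{i,j\}$ with $a_{ij}=\ast$). For $\mathbf{x}\in\mathbb{R}^m_+$,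 let $\mathbf{A}(\mathbf{x})$ be the complete pairwise comparison matrix obtained from $\mathbf{A}$ by replacing the missing entries $a_{ij}$ with $i<j$ by the coordinates of $\mathbf{x}$ and the missing entries $a_{ji}$ by the corresponding reciprocals. Let $\lambda_{\max}(\mathbf{A}(\mathbf{x}))$ denote the dominant (Perron) eigenvalue of this positive matrix. The eigenvalue optimal completion of $\mathbf{A}$ is $\mathbf{A}(\mathbf{x}^* )$, where $\mathbf{x}^*$ is the minimiser of $\lambda_{\max}(\mathbf{A}(\mathbf{x}))$ over $\mathbf{x}\in\mathbb{R}^m_+$. It is known (Bozóki, Fülöp, Rónyai, 2010) that both optimal completions exist and are unique if and only if $G$ is connected (with $\mathbf{w}$ unique up to multiplication by a positive scalar). *)

theory Defs
  imports "Jordan_Normal_Form.Char_Poly" "HOL-Library.FuncSet"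
begin

text \<open>Matrices are those of Jordan_Normal_Form, so the index set of a matrix of order \<open>n\<close> is
  \<open>{0..<n}\<close> instead of \<open>{1..n}\<close>. A missing entry is \<open>None\<close>.\<close>

definition incomplete_pcm :: "nat \<Rightarrow> real option mat \<Rightarrow> bool" where
  "incomplete_pcm n A \<longleftrightarrow> A \<in> carrier_mat n n \<and>
     (\<forall>i<n. A $$ (i, i) = Some 1) \<and>
     (\<forall>i<n. \<forall>j<n. \<forall>a. A $$ (i, j) = Some a \<longrightarrow> a > 0 \<and> A $$ (j, i) = Some (1 / a)) \<and>
     (\<forall>i<n. \<forall>j<n. A $$ (i, j) = None \<longrightarrow> A $$ (j, i) = None)"

definition known :: "real option mat \<Rightarrow> (nat \<times> nat) set" where
  "known A = {(i, j). i < dim_row A \<and> j < dim_row A \<and> A $$ (i, j) \<noteq> None}"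

text \<open>The undirected graph is given by its symmetric adjacency relation; connectedness means that
  any two vertices are joined by a walk.\<close>

definition pcm_edges :: "real option mat \<Rightarrow> (nat \<times> nat) set" where
  "pcm_edges A = {(i, j) \<in> known A. i \<noteq> j}"

definition connected_pcm :: "real option mat \<Rightarrow> bool" where
  "connected_pcm A \<longleftrightarrow> (\<forall>i<dim_row A. \<forall>j<dim_row A. (i, j) \<in> (pcm_edges A)\<^sup>*)"

definition lls_objective :: "real option mat \<Rightarrow> real vec \<Rightarrow> real" where
  "lls_objective A w = (\<Sum>(i, j)\<in>known A. (ln (the (A $$ (i, j))) - ln (w $ i / w $ j))\<^sup>2)"

definition positive_vec :: "nat \<Rightarrow> real vec \<Rightarrow> bool" where
  "positive_vec n w \<longleftrightarrow> w \<in> carrier_vec n \<and> (\<forall>i<n. w $ i > 0)"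

definition is_lls_completion :: "real option mat \<Rightarrow> real mat \<Rightarrow> bool" where
  "is_lls_completion A B \<longleftrightarrow>
     (\<exists>w. is_arg_min (lls_objective A) (positive_vec (dim_row A)) w \<and>
        B = mat (dim_row A) (dim_row A)
              (\<lambda>(i, j). case A $$ (i, j) of Some a \<Rightarrow> a | None \<Rightarrow> w $ i / w $ j))"

text \<open>A point of the positive orthant of dimension \<open>m\<close> is represented as a positive function on the
  set of the \<open>m\<close> missing positions above the diagonal.\<close>

definition missing :: "real option mat \<Rightarrow> (nat \<times> nat) set" where
  "missing A = {(i, j). i < j \<and> j < dim_row A \<and> A $$ (i, j) = None}"

definition fill :: "real option mat \<Rightarrow> (nat \<times> nat \<Rightarrow> real) \<Rightarrow> real mat" where
  "fill A x = mat (dim_row A) (dim_row A)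
     (\<lambda>(i, j). case A $$ (i, j) of Some a \<Rightarrow> a
        | None \<Rightarrow> if i < j then x (i, j) else 1 / x (j, i))"

text \<open>The real eigenvalue that bounds the modulus of every complex eigenvalue: at most one such
  number exists, and for a positive square matrix of positive order it exists by Perron's theorem.\<close>

definition lambda_max :: "real mat \<Rightarrow> real" where
  "lambda_max M = (THE r. eigenvalue M r \<and>
     (\<forall>z. eigenvalue (map_mat complex_of_real M) z \<longrightarrow> cmod z \<le> r))"

definition is_eigenvalue_completion :: "real option mat \<Rightarrow> real mat \<Rightarrow> bool" where
  "is_eigenvalue_completion A B \<longleftrightarrow>
     (\<exists>x. is_arg_min (\<lambda>y. lambda_max (fill A y)) (\<lambda>y. y \<in> missing A \<rightarrow>\<^sub>E {0<..}) x \<and>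
        B = fill A x)"

end

theory Submission
  imports Defs "Jordan_Normal_Form.Spectral_Radius"
begin

text \<open>In the counterexample a single entry, at position \<open>(0, 1)\<close>, is missing. Setting it to \<open>1\<close> gives
  a matrix \<open>M\<close> whose leading six by six block has all row sums and all column sums equal, while all
  entries outside this block are \<open>1\<close>. Hence \<open>M\<close> has the same left and right Perron vector, which makes
  \<open>M\<close> the eigenvalue optimal completion. Least squares optimality of \<open>M\<close> would instead require rows \<open>0\<close> and \<open>1\<close> to have equal products of entries,
  which they do not.\<close>

section \<open>Perron vectors of positive matrices\<close>

text \<open>The counterexample plays sums of entries against products. At a missing pair,
  \<open>lambda_max\<close> is stationary when \<open>u i * m i j * v j\<close> is symmetric in
  \<open>i\<close> and \<open>j\<close>, for \<open>u\<close> and \<open>v\<close> the left and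
  right Perron vectors; this is automatic if \<open>u = v\<close> and the pair is filled with 1.
  Equal row and column sums provide \<open>u = v\<close>, whereas least squares sees only sums of
  logarithms. Writing the entries as exp (arsinh s) separates the two: an entry and its reciprocal
  differ by 2 s, which is linear in s, while the logarithm is not. Padding by ones keeps the Perron
  vector constant on two blocks, so a single block of order 6 serves every larger order. The
  obstacle is that minimality is a comparison with all fillings, whose Perron vectors have no
  convenient closed form. A tangent inequality copes with them, since it needs only some positive
  eigenvector of the competitor; its equality case gives uniqueness.\<close>

lemma index_mult_mat_vec_sum:
  fixes M :: "'a :: comm_semiring_0 mat"
  assumes "M \<in> carrier_mat n n" "v \<in> carrier_vec n" "i < n"
  shows "(M *\<^sub>v v) $ i = (\<Sum>j\<in>{0..<n}. M $$ (i, j) * v $ j)"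
  using assms by (auto simp: scalar_prod_def intro!: sum.cong)

lemma eigenvector_coords:
  fixes M :: "'a :: comm_ring_1 mat"
  assumes "M \<in> carrier_mat n n" "v \<in> carrier_vec n" "M *\<^sub>v v = r \<cdot>\<^sub>v v" "i < n"
  shows "(\<Sum>j\<in>{0..<n}. M $$ (i, j) * v $ j) = r * v $ i"
proof -
  have "(M *\<^sub>v v) $ i = (r \<cdot>\<^sub>v v) $ i"
    using assms(3) by simp
  then show ?thesis
    using index_mult_mat_vec_sum[OF assms(1,2,4)] assms(2,4) by simp
qed

lemma eigenvectorI_coords:
  fixes M :: "'a :: comm_ring_1 mat"
  assumes "M \<in> carrier_mat n n" "v \<in> carrier_vec n"
    and "\<And>i. i < n \<Longrightarrow> (\<Sum>j\<in>{0..<n}. M $$ (i, j) * v $ j) = r * v $ i"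
  shows "M *\<^sub>v v = r \<cdot>\<^sub>v v"
proof (rule eq_vecI)
  show "dim_vec (M *\<^sub>v v) = dim_vec (r \<cdot>\<^sub>v v)"
    using assms by auto
  fix i assume "i < dim_vec (r \<cdot>\<^sub>v v)"
  then have i: "i < n"
    using assms by auto
  show "(M *\<^sub>v v) $ i = (r \<cdot>\<^sub>v v) $ i"
    using index_mult_mat_vec_sum[OF assms(1,2) i] assms(3)[OF i] i assms(2) by simp
qed

lemma nonzero_vec_coord:
  assumes "v \<in> carrier_vec n" "v \<noteq> 0\<^sub>v n"
  obtains k where "k < n" "v $ k \<noteq> 0"
proof -
  have "\<exists>k<n. v $ k \<noteq> 0"
  proof (rule ccontr)
    assume "\<not> ?thesis"
    then have "v = 0\<^sub>v n"
      using assms(1) by (intro eq_vecI) auto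
    then show False
      using assms(2) by contradiction
  qed
  then show thesis
    using that by blast
qed

text \<open>The least \<open>t\<close> with |y| \<le> t v is attained at some coordinate
  \<open>i\<close>. The triangle inequality in row \<open>i\<close> of the eigenvalue equation then
  bounds \<open>cmod z * (t * v $ i)\<close> by \<open>r * (t * v $ i)\<close>.\<close>

lemma norm_eigenvalue_le_positive_eigenvector:
  assumes M: "M \<in> carrier_mat n n" and n: "n > 0"
    and nn: "\<And>i j. i < n \<Longrightarrow> j < n \<Longrightarrow> M $$ (i, j) \<ge> 0"
    and v: "positive_vec n v" and ev: "M *\<^sub>v v = r \<cdot>\<^sub>v v"
    and z: "eigenvalue (map_mat complex_of_real M) z"
  shows "cmod z \<le> r"
proof -
  let ?C = "map_mat complex_of_real M"
  have C: "?C \<in> carrier_mat n n"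
    using M by simp
  from z obtain y where y: "y \<in> carrier_vec n" "y \<noteq> 0\<^sub>v n" "?C *\<^sub>v y = z \<cdot>\<^sub>v y"
    using M unfolding eigenvalue_def eigenvector_def by auto
  have v': "v \<in> carrier_vec n" "\<And>i. i < n \<Longrightarrow> v $ i > 0"
    using v by (auto simp: positive_vec_def)
  define q where "q i = cmod (y $ i) / v $ i" for i
  define t where "t = Max (q ` {0..<n})"
  have "t \<in> q ` {0..<n}"
    unfolding t_def using n by (intro Max_in) auto
  then obtain i where i: "i < n" "q i = t" by auto
  have qle: "q j \<le> t" if "j < n" for j
    unfolding t_def using that by (intro Max_ge) auto
  have yle: "cmod (y $ j) \<le> t * v $ j" if "j < n" for j
    using qle[OF that] v'(2)[OF that] by (simp add: q_def divide_simps)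
  have yi: "cmod (y $ i) = t * v $ i"
    using i v'(2)[OF i(1)] by (auto simp: q_def divide_simps)
  have "t > 0"
  proof -
    obtain k where "k < n" "y $ k \<noteq> 0"
      using nonzero_vec_coord[OF y(1,2)] .
    then have "q k > 0"
      using v'(2) by (simp add: q_def)
    then show ?thesis
      using qle[OF \<open>k < n\<close>] by linarith
  qed
  have "cmod z * (t * v $ i) = cmod (\<Sum>j\<in>{0..<n}. ?C $$ (i, j) * y $ j)"
    unfolding eigenvector_coords[OF C y(1,3) i(1)] norm_mult yi ..
  also have "\<dots> \<le> (\<Sum>j\<in>{0..<n}. cmod (?C $$ (i, j) * y $ j))"
    by (rule norm_sum)
  also have "\<dots> \<le> (\<Sum>j\<in>{0..<n}. M $$ (i, j) * (t * v $ j))"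
    using M i(1) nn yle by (intro sum_mono) (auto simp: norm_mult intro!: mult_left_mono)
  also have "\<dots> = t * (\<Sum>j\<in>{0..<n}. M $$ (i, j) * v $ j)"
    by (simp add: sum_distrib_left mult_ac)
  also have "\<dots> = r * (t * v $ i)"
    unfolding eigenvector_coords[OF M v'(1) ev i(1)] by simp
  finally show ?thesis
    using \<open>t > 0\<close> v'(2)[OF i(1)] by simp
qed

text \<open>Two numbers that fit the description in \<open>lambda_max\<close> are eigenvalues that
  bound each other, hence equal. A positive eigenvector therefore suffices to evaluate
  \<open>lambda_max\<close>.\<close>

lemma lambda_max_eqI:
  assumes M: "M \<in> carrier_mat n n" and n: "n > 0"
    and nn: "\<And>i j. i < n \<Longrightarrow> j < n \<Longrightarrow> M $$ (i, j) \<ge> 0"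
    and v: "positive_vec n v" and ev: "M *\<^sub>v v = r \<cdot>\<^sub>v v"
  shows "lambda_max M = r"
proof -
  have v': "v \<in> carrier_vec n" "v $ 0 > 0"
    using v n by (auto simp: positive_vec_def)
  then have "v \<noteq> 0\<^sub>v n"
    using n by auto
  then have evr: "eigenvalue M r"
    using M v' ev unfolding eigenvalue_def eigenvector_def by auto
  have le: "cmod z \<le> r" if "eigenvalue (map_mat complex_of_real M) z" for z
    using norm_eigenvalue_le_positive_eigenvector[OF M n nn v ev that] .
  have complex: "eigenvalue (map_mat complex_of_real M) (complex_of_real s)" if "eigenvalue M s" for s
    using of_real_hom.eigenvalue_hom[OF M that] .
  have "0 \<le> r"
    using le[OF complex[OF evr]] norm_ge_zero order_trans by blast
  show ?thesis
    unfolding lambda_max_def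
  proof (rule the_equality)
    show "eigenvalue M r \<and> (\<forall>z. eigenvalue (map_mat complex_of_real M) z \<longrightarrow> cmod z \<le> r)"
      using evr le by blast
    fix s assume s: "eigenvalue M s \<and>
      (\<forall>z. eigenvalue (map_mat complex_of_real M) z \<longrightarrow> cmod z \<le> s)"
    have "s \<le> r"
      using le[OF complex] s by fastforce
    moreover have "r \<le> s"
      using s complex[OF evr] by fastforce
    ultimately show "s = r" by simp
  qed
qed

text \<open>A sub-invariant vector \<open>w\<close> with factor \<open>q > 1\<close> makes the powers of \<open>M\<close> grow like \<open>q ^ k\<close>,
  which the boundedness of the powers for spectral radius below \<open>1\<close> excludes.\<close>

lemma spectral_radius_subinvariant:
  assumes M: "M \<in> carrier_mat n n" and n: "n > 0"
    and nn: "\<And>i j. i < n \<Longrightarrow> j < n \<Longrightarrow> M $$ (i, j) \<ge> 0"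
    and w: "positive_vec n w" and q: "q > 1"
    and sub: "\<And>i. i < n \<Longrightarrow> q * w $ i \<le> (M *\<^sub>v w) $ i"
  shows "\<not> spectral_radius (map_mat complex_of_real M) < 1"
proof
  let ?C = "map_mat complex_of_real M"
  assume sr: "spectral_radius ?C < 1"
  have C: "?C \<in> carrier_mat n n"
    using M by simp
  from spectral_radius_jnf_norm_bound_less_1_upper_triangular[OF C sr]
  obtain c where c: "\<And>k. norm_bound (?C ^\<^sub>m k) c" by blast
  have w': "w \<in> carrier_vec n" "\<And>i. i < n \<Longrightarrow> w $ i > 0"
    using w by (auto simp: positive_vec_def)
  have Mk: "M ^\<^sub>m k \<in> carrier_mat n n" for k
    using M by (rule pow_carrier_mat)
  have bound: "\<bar>(M ^\<^sub>m k) $$ (i, j)\<bar> \<le> c" if "i < n" "j < n" for k i j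
  proof -
    have "norm ((?C ^\<^sub>m k) $$ (i, j)) \<le> c"
      using c[of k] that C unfolding norm_bound_def by auto
    then show ?thesis
      using that M Mk[of k] unfolding of_real_hom.mat_hom_pow[OF M, symmetric] by auto
  qed
  have grow: "q ^ k * w $ i \<le> (M ^\<^sub>m k *\<^sub>v w) $ i" if "i < n" for k i
    using that
  proof (induction k arbitrary: i)
    case 0
    then show ?case using M w'(1) by simp
  next
    case (Suc k)
    have "q ^ Suc k * w $ i = q ^ k * (q * w $ i)" by simp
    also have "\<dots> \<le> q ^ k * (M *\<^sub>v w) $ i"
      using sub[OF Suc.prems] q by (intro mult_left_mono) auto
    also have "\<dots> = (\<Sum>j\<in>{0..<n}. M $$ (i, j) * (q ^ k * w $ j))"
      by (simp add: index_mult_mat_vec_sum[OF M w'(1) Suc.prems] sum_distrib_left mult_ac)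
    also have "\<dots> \<le> (\<Sum>j\<in>{0..<n}. M $$ (i, j) * (M ^\<^sub>m k *\<^sub>v w) $ j)"
      using Suc nn by (intro sum_mono mult_left_mono) auto
    also have "\<dots> = (M *\<^sub>v (M ^\<^sub>m k *\<^sub>v w)) $ i"
      using Mk[of k] w'(1) Suc.prems by (intro index_mult_mat_vec_sum[OF M, symmetric]) auto
    \<comment> \<open>Matrix powers unfold with the new factor on the right; the monoid law
      \<open>nat_pow_Suc2\<close> moves it to the left.\<close>
    also have "M *\<^sub>v (M ^\<^sub>m k *\<^sub>v w) = M ^\<^sub>m Suc k *\<^sub>v w"
      unfolding assoc_mult_mat_vec[OF M Mk w'(1), symmetric]
      using M
      by (metis pow_mat_ring_pow ring_mat_simps(1) ring_mat_simps(5) semiring_mat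
          monoid.nat_pow_Suc2 semiring_def)
    finally show ?case .
  qed
  define b where "b = (\<Sum>j\<in>{0..<n}. c * w $ j) / w $ 0"
  have w0: "w $ 0 > 0"
    using w'(2) n by blast
  have "q ^ k \<le> b" for k
  proof -
    have "q ^ k * w $ 0 \<le> (M ^\<^sub>m k *\<^sub>v w) $ 0"
      by (rule grow[OF n])
    also have "\<dots> = (\<Sum>j\<in>{0..<n}. (M ^\<^sub>m k) $$ (0, j) * w $ j)"
      by (rule index_mult_mat_vec_sum[OF Mk w'(1) n])
    also have "\<dots> \<le> (\<Sum>j\<in>{0..<n}. c * w $ j)"
    proof (rule sum_mono)
      fix j assume "j \<in> {0..<n}"
      then show "(M ^\<^sub>m k) $$ (0, j) * w $ j \<le> c * w $ j"
        using bound[of 0 j k] n w'(2)[of j] by (intro mult_right_mono) auto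
    qed
    finally show ?thesis
      using w0 by (simp add: b_def divide_simps)
  qed
  then show False
    using real_arch_pow[OF q, of b] by (meson not_less)
qed

text \<open>Take a complex eigenvector \<open>x\<close> for an eigenvalue of maximal modulus
  \<open>r\<close> and replace its coordinates by their moduli. The triangle inequality gives r y
  \<le> M y, and a strict inequality anywhere would push the spectral radius above \<open>r\<close>.
  So \<open>y\<close> is an eigenvector, and it is positive because \<open>M *\<^sub>v y\<close>
  is.\<close>

lemma Perron_exists:
  assumes M: "M \<in> carrier_mat n n" and n: "n > 0"
    and pos: "\<And>i j. i < n \<Longrightarrow> j < n \<Longrightarrow> M $$ (i, j) > (0 :: real)"
  obtains r v where "positive_vec n v" "M *\<^sub>v v = r \<cdot>\<^sub>v v"
proof -
  let ?C = "map_mat complex_of_real M"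
  have C: "?C \<in> carrier_mat n n"
    using M by simp
  define r where "r = spectral_radius ?C"
  from spectral_radius_mem_max(1)[OF C n] obtain z where
    z: "eigenvalue ?C z" "cmod z = r"
    unfolding r_def spectrum_def by auto
  from z obtain x where x: "x \<in> carrier_vec n" "x \<noteq> 0\<^sub>v n" "?C *\<^sub>v x = z \<cdot>\<^sub>v x"
    using M unfolding eigenvalue_def eigenvector_def by auto
  define y where "y = vec n (\<lambda>i. cmod (x $ i))"
  have y: "y \<in> carrier_vec n" "\<And>i. i < n \<Longrightarrow> y $ i = cmod (x $ i)"
    by (auto simp: y_def)
  obtain k where k: "k < n" "x $ k \<noteq> 0"
    using nonzero_vec_coord[OF x(1,2)] .
  define w where "w = M *\<^sub>v y"
  have w: "w \<in> carrier_vec n"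
    using M y by (auto simp: w_def)
  have wi: "w $ i = (\<Sum>j\<in>{0..<n}. M $$ (i, j) * y $ j)" if "i < n" for i
    unfolding w_def by (rule index_mult_mat_vec_sum[OF M y(1) that])
  have sub: "r * y $ i \<le> w $ i" if i: "i < n" for i
  proof -
    have "r * y $ i = cmod (\<Sum>j\<in>{0..<n}. ?C $$ (i, j) * x $ j)"
      unfolding eigenvector_coords[OF C x(1,3) i] norm_mult y(2)[OF i] z(2) ..
    also have "\<dots> \<le> (\<Sum>j\<in>{0..<n}. cmod (?C $$ (i, j) * x $ j))"
      by (rule norm_sum)
    also have "\<dots> = w $ i"
      unfolding wi[OF i] using M i pos
      by (intro sum.cong) (auto simp: norm_mult y(2) abs_of_pos)
    finally show ?thesis .
  qed
  have pos_apply: "(\<Sum>j\<in>{0..<n}. M $$ (i, j) * f j) > 0"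
    if "i < n" "\<And>j. j < n \<Longrightarrow> f j \<ge> 0" "l < n" "f l > 0" for i f l
  proof (rule sum_pos2[where i = l])
    show "0 \<le> M $$ (i, j) * f j" if "j \<in> {0..<n}" for j
      using \<open>i < n\<close> that \<open>\<And>j. j < n \<Longrightarrow> f j \<ge> 0\<close> pos[of i j] by simp
  qed (use that pos in auto)
  have wpos: "w $ i > 0" if "i < n" for i
    unfolding wi[OF that] using k y(2) by (intro pos_apply[OF that _ k(1)]) auto
  have wvec: "positive_vec n w"
    using w wpos by (auto simp: positive_vec_def)
  have r0: "r \<ge> 0"
    using z(2) norm_ge_zero by metis
  have eq: "w $ i = r * y $ i" if "i < n" for i
  proof (rule ccontr)
    assume "w $ i \<noteq> r * y $ i"
    then have gap: "w $ i - r * y $ i > 0"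
      using sub[OF that] by simp
    \<comment> \<open>A single positive coordinate of the nonnegative vector M y - r y becomes
      positivity everywhere once the positive matrix \<open>M\<close> is applied.\<close>
    have strict: "r * w $ l < (M *\<^sub>v w) $ l" if l: "l < n" for l
    proof -
      have "0 < (\<Sum>j\<in>{0..<n}. M $$ (l, j) * (w $ j - r * y $ j))"
        using sub gap \<open>i < n\<close> by (intro pos_apply[OF l]) auto
      also have "\<dots> = (M *\<^sub>v w) $ l - r * w $ l"
        unfolding index_mult_mat_vec_sum[OF M w l] wi[OF l]
        by (simp add: algebra_simps sum_subtractf sum_distrib_left)
      finally show ?thesis by simp
    qed
    \<comment> \<open>The Collatz-Wielandt number of \<open>w\<close>: the largest factor for which
      \<open>w\<close> is sub-invariant.\<close>
    define s where "s = Min ((\<lambda>l. (M *\<^sub>v w) $ l / w $ l) ` {0..<n})"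
    have sle: "s * w $ l \<le> (M *\<^sub>v w) $ l" if "l < n" for l
    proof -
      have "s \<le> (M *\<^sub>v w) $ l / w $ l"
        unfolding s_def using that by (intro Min_le) auto
      then show ?thesis
        using wpos[OF that] by (simp add: divide_simps)
    qed
    have "s \<in> (\<lambda>l. (M *\<^sub>v w) $ l / w $ l) ` {0..<n}"
      unfolding s_def using n by (intro Min_in) auto
    then obtain l where l: "l < n" "s = (M *\<^sub>v w) $ l / w $ l" by auto
    have rs: "r < s"
      using strict[OF l(1)] wpos[OF l(1)] l(2) by (simp add: less_divide_eq)
    \<comment> \<open>Any value strictly between \<open>r\<close> and \<open>s\<close> works: after
      division by \<open>t\<close> the spectral radius is below 1, yet the sub-invariance factor
      \<open>s / t\<close> exceeds 1.\<close>
    define t where "t = (r + s) / 2"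
    have t: "r < t" "t < s" "t > 0"
      using rs r0 by (auto simp: t_def)
    define B where "B = (1 / t) \<cdot>\<^sub>m M"
    have B: "B \<in> carrier_mat n n"
      using M by (simp add: B_def)
    have "spectral_radius (map_mat complex_of_real B) < 1"
    proof -
      have CB: "map_mat complex_of_real B \<in> carrier_mat n n"
        using B by simp
      from spectral_radius_mem_max(1)[OF CB n] obtain a where
        a: "eigenvalue (map_mat complex_of_real B) a"
           "cmod a = spectral_radius (map_mat complex_of_real B)"
        unfolding spectrum_def by auto
      from a obtain u where u: "u \<in> carrier_vec n" "u \<noteq> 0\<^sub>v n"
          "map_mat complex_of_real B *\<^sub>v u = a \<cdot>\<^sub>v u"
        using B unfolding eigenvalue_def eigenvector_def by auto
      have "?C *\<^sub>v u = (complex_of_real t * a) \<cdot>\<^sub>v u"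
      proof (rule eigenvectorI_coords[OF C u(1)])
        fix i assume i: "i < n"
        have "(\<Sum>j\<in>{0..<n}. ?C $$ (i, j) * u $ j) =
            complex_of_real t * (\<Sum>j\<in>{0..<n}. map_mat complex_of_real B $$ (i, j) * u $ j)"
          unfolding sum_distrib_left
          using M i t(3) by (intro sum.cong) (auto simp: B_def)
        then show "(\<Sum>j\<in>{0..<n}. ?C $$ (i, j) * u $ j) = complex_of_real t * a * u $ i"
          unfolding eigenvector_coords[OF CB u(1,3) i] by simp
      qed
      then have "eigenvalue ?C (complex_of_real t * a)"
        using u M unfolding eigenvalue_def eigenvector_def by auto
      then have "cmod (complex_of_real t * a) \<le> r"
        unfolding r_def by (intro spectral_radius_mem_max(2)[OF C n]) (auto simp: spectrum_def)
      then have "t * cmod a < t * 1"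
        using t by (simp only: norm_mult norm_of_real mult_1_right)
      then have "cmod a < 1"
        using t(3) mult_less_cancel_left_pos by blast
      then show ?thesis
        using a(2) by simp
    qed
    moreover have "\<not> spectral_radius (map_mat complex_of_real B) < 1"
    proof (rule spectral_radius_subinvariant[OF B n _ wvec, of "s / t"])
      show "0 \<le> B $$ (i, j)" if "i < n" "j < n" for i j
        using that M t(3) pos[OF that] by (simp add: B_def)
      show "1 < s / t"
        using t by simp
      show "s / t * w $ l \<le> (B *\<^sub>v w) $ l" if "l < n" for l
      proof -
        have "(B *\<^sub>v w) $ l = (1 / t) * (M *\<^sub>v w) $ l"
          unfolding index_mult_mat_vec_sum[OF B w that] index_mult_mat_vec_sum[OF M w that]
            sum_distrib_left
          using that M by (intro sum.cong) (auto simp: B_def)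
        then show ?thesis
          using sle[OF that] t(3) by (simp add: divide_simps)
      qed
    qed
    ultimately show False by contradiction
  qed
  have "M *\<^sub>v y = r \<cdot>\<^sub>v y"
    using eq y(1) M unfolding w_def by (intro eq_vecI) auto
  moreover have "positive_vec n y"
    unfolding positive_vec_def
  proof (intro conjI allI impI y(1))
    fix i assume i: "i < n"
    have "r * y $ i > 0"
      using wpos[OF i] eq[OF i] by simp
    then show "y $ i > 0"
      using r0 by (simp add: zero_less_mult_iff)
  qed
  ultimately show thesis
    using that by blast
qed

text \<open>Convexity of the Perron root in the logarithms of the entries: the derivative at
  \<open>M\<close> in the direction ln (N / M) is proportional to the sum in \<open>balance\<close>,
  so \<open>balance\<close> makes the tangent horizontal. The proof weights ln t \<le> t - 1 by
  \<open>p i j\<close>. Equality forces every \<open>t i j\<close> to be 1, that is,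
  \<open>N\<close> arises from \<open>M\<close> by a diagonal similarity with ratios
  \<open>z / v\<close>.\<close>

lemma Perron_root_tangent:
  fixes M N :: "nat \<Rightarrow> nat \<Rightarrow> real" and u v z :: "nat \<Rightarrow> real"
  assumes n: "n > 0"
    and M: "\<And>i j. i < n \<Longrightarrow> j < n \<Longrightarrow> M i j > 0"
    and N: "\<And>i j. i < n \<Longrightarrow> j < n \<Longrightarrow> N i j > 0"
    and u: "\<And>i. i < n \<Longrightarrow> u i > 0"
    and v: "\<And>i. i < n \<Longrightarrow> v i > 0"
    and z: "\<And>i. i < n \<Longrightarrow> z i > 0"
    and Mv: "\<And>i. i < n \<Longrightarrow> (\<Sum>j\<in>{0..<n}. M i j * v j) = a * v i"
    and uM: "\<And>j. j < n \<Longrightarrow> (\<Sum>i\<in>{0..<n}. u i * M i j) = a * u j"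
    and Nz: "\<And>i. i < n \<Longrightarrow> (\<Sum>j\<in>{0..<n}. N i j * z j) = b * z i"
    and balance: "(\<Sum>i\<in>{0..<n}. \<Sum>j\<in>{0..<n}. u i * M i j * v j * ln (N i j / M i j)) = 0"
  shows "a \<le> b"
    and "a = b \<Longrightarrow> i < n \<Longrightarrow> j < n \<Longrightarrow> N i j * z j * v i = M i j * v j * z i"
proof -
  define p where "p i j = u i * M i j * v j" for i j
  define g where "g i = ln (z i / v i)" for i
  \<comment> \<open>Ratio of the shares that column \<open>j\<close> has in row \<open>i\<close> of
    N z = b z and of M v = a v, up to the factor b / a.\<close>
  define t where "t i j = N i j * z j * v i / (M i j * v j * z i)" for i j
  define W where "W = (\<Sum>i\<in>{0..<n}. u i * v i)"
  have W: "W > 0"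
    unfolding W_def using n u v by (intro sum_pos) auto
  have p: "p i j > 0" and t: "t i j > 0" if "i < n" "j < n" for i j
    using that M N u v z by (auto simp: p_def t_def)
  have row: "(\<Sum>j\<in>{0..<n}. p i j) = a * (u i * v i)" if "i < n" for i
  proof -
    have "(\<Sum>j\<in>{0..<n}. p i j) = u i * (\<Sum>j\<in>{0..<n}. M i j * v j)"
      by (simp add: p_def sum_distrib_left mult_ac)
    then show ?thesis
      using Mv[OF that] by simp
  qed
  have col: "(\<Sum>i\<in>{0..<n}. p i j) = a * (u j * v j)" if "j < n" for j
  proof -
    have "(\<Sum>i\<in>{0..<n}. p i j) = (\<Sum>i\<in>{0..<n}. u i * M i j) * v j"
      by (simp add: p_def sum_distrib_right)
    then show ?thesis
      using uM[OF that] by simp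
  qed
  have sum_p: "(\<Sum>i\<in>{0..<n}. \<Sum>j\<in>{0..<n}. p i j) = a * W"
    by (simp add: row W_def sum_distrib_left)
  have sum_pt: "(\<Sum>i\<in>{0..<n}. \<Sum>j\<in>{0..<n}. p i j * t i j) = b * W"
    unfolding W_def sum_distrib_left
  proof (rule sum.cong[OF refl])
    fix i assume "i \<in> {0..<n}"
    then have i: "i < n" by simp
    have "(\<Sum>j\<in>{0..<n}. p i j * t i j) = (\<Sum>j\<in>{0..<n}. u i * v i / z i * (N i j * z j))"
    proof (rule sum.cong[OF refl])
      fix j assume "j \<in> {0..<n}"
      then have "M i j > 0" "v j > 0" "z i > 0"
        using i M v z by auto
      then show "p i j * t i j = u i * v i / z i * (N i j * z j)"
        by (simp add: p_def t_def field_simps)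
    qed
    also have "\<dots> = u i * v i / z i * (b * z i)"
      unfolding sum_distrib_left[symmetric] Nz[OF i] ..
    also have "\<dots> = b * (u i * v i)"
      using z[OF i] by simp
    finally show "(\<Sum>j\<in>{0..<n}. p i j * t i j) = b * (u i * v i)" .
  qed
  have ln_t: "ln (t i j) = ln (N i j / M i j) + g j - g i" if "i < n" "j < n" for i j
    using M[OF that] N[OF that] v[OF that(1)] v[OF that(2)] z[OF that(1)] z[OF that(2)]
    by (simp add: t_def g_def ln_div ln_mult)
  \<comment> \<open>The potential \<open>g\<close> cancels because \<open>p\<close> has the same row
    and column marginals \<open>a * (u i * v i)\<close>; only the sum from \<open>balance\<close>
    survives.\<close>
  have "(\<Sum>i\<in>{0..<n}. \<Sum>j\<in>{0..<n}. p i j * ln (t i j)) =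
      (\<Sum>i\<in>{0..<n}. \<Sum>j\<in>{0..<n}. p i j * ln (N i j / M i j) + p i j * g j - p i j * g i)"
    by (intro sum.cong refl) (simp add: ln_t algebra_simps)
  also have "\<dots> = (\<Sum>i\<in>{0..<n}. \<Sum>j\<in>{0..<n}. p i j * ln (N i j / M i j))
      + (\<Sum>i\<in>{0..<n}. \<Sum>j\<in>{0..<n}. p i j * g j) - (\<Sum>i\<in>{0..<n}. \<Sum>j\<in>{0..<n}. p i j * g i)"
    by (simp add: sum.distrib sum_subtractf)
  also have "(\<Sum>i\<in>{0..<n}. \<Sum>j\<in>{0..<n}. p i j * g j) = (\<Sum>j\<in>{0..<n}. a * (u j * v j) * g j)"
    by (subst sum.swap) (simp add: sum_distrib_right[symmetric] col)
  also have "(\<Sum>i\<in>{0..<n}. \<Sum>j\<in>{0..<n}. p i j * g i) = (\<Sum>i\<in>{0..<n}. a * (u i * v i) * g i)"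
    by (simp add: sum_distrib_right[symmetric] row)
  also have "(\<Sum>i\<in>{0..<n}. \<Sum>j\<in>{0..<n}. p i j * ln (N i j / M i j)) = 0"
    using balance by (simp add: p_def)
  finally have sum_ln: "(\<Sum>i\<in>{0..<n}. \<Sum>j\<in>{0..<n}. p i j * ln (t i j)) = 0"
    by simp
  define h where "h i j = p i j * (t i j - 1 - ln (t i j))" for i j
  have h: "h i j \<ge> 0" if "i < n" "j < n" for i j
    unfolding h_def using p[OF that] ln_le_minus_one[OF t[OF that]]
    by (intro mult_nonneg_nonneg) auto
  have sum_h: "(\<Sum>i\<in>{0..<n}. \<Sum>j\<in>{0..<n}. h i j) = (b - a) * W"
    using sum_p sum_pt sum_ln by (simp add: h_def algebra_simps sum.distrib sum_subtractf)
  have "0 \<le> (\<Sum>i\<in>{0..<n}. \<Sum>j\<in>{0..<n}. h i j)"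
    using h by (intro sum_nonneg) auto
  then show "a \<le> b"
    unfolding sum_h using W by (simp add: zero_le_mult_iff)
  assume ab: "a = b" and i: "i < n" and j: "j < n"
  have "(\<Sum>j\<in>{0..<n}. h i j) = 0"
  proof (rule sum_nonneg_0[of "{0..<n}" "\<lambda>i. \<Sum>j\<in>{0..<n}. h i j"])
    show "\<And>i. i \<in> {0..<n} \<Longrightarrow> 0 \<le> (\<Sum>j\<in>{0..<n}. h i j)"
      using h by (intro sum_nonneg) auto
  qed (use sum_h ab i in auto)
  then have "h i j = 0"
    using h i j by (intro sum_nonneg_0[of "{0..<n}" "h i"]) auto
  then have "ln (t i j) = t i j - 1"
    using p[OF i j] by (simp add: h_def)
  then have "t i j = 1"
    using ln_eq_minus_one[OF t[OF i j]] by blast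
  then show "N i j * z j * v i = M i j * v j * z i"
    by (simp add: t_def)
qed

section \<open>Optimality conditions for the two completions\<close>

lemma incomplete_pcmD:
  assumes "incomplete_pcm n A"
  shows "A \<in> carrier_mat n n" "dim_row A = n"
    and "i < n \<Longrightarrow> A $$ (i, i) = Some 1"
    and "i < n \<Longrightarrow> j < n \<Longrightarrow> A $$ (i, j) = Some a \<Longrightarrow> a > 0"
    and "i < n \<Longrightarrow> j < n \<Longrightarrow> A $$ (i, j) = Some a \<Longrightarrow> A $$ (j, i) = Some (1 / a)"
    and "i < n \<Longrightarrow> j < n \<Longrightarrow> A $$ (i, j) = None \<Longrightarrow> A $$ (j, i) = None"
  using assms carrier_matD(1) unfolding incomplete_pcm_def by blast+

lemma fill_reciprocal:
  assumes A: "incomplete_pcm n A" and x: "x \<in> missing A \<rightarrow>\<^sub>E {0<..}"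
    and i: "i < n" and j: "j < n"
  shows "fill A x $$ (i, j) > 0" "fill A x $$ (j, i) = 1 / fill A x $$ (i, j)"
proof -
  note D = incomplete_pcmD[OF A]
  have xpos: "x (k, l) > 0" if "k < l" "l < n" "A $$ (k, l) = None" for k l
    using x that D(2) by (auto simp: missing_def PiE_def Pi_def)
  show "fill A x $$ (i, j) > 0"
  proof (cases "A $$ (i, j)")
    case None
    then have "i \<noteq> j"
      using D(3)[OF i] by auto
    then show ?thesis
      using None D(2) D(6)[OF i j None] i j xpos[of i j] xpos[of j i]
      by (cases "i < j") (auto simp: fill_def)
  next
    case (Some a)
    then show ?thesis
      using D(2) D(4)[OF i j Some] i j by (simp add: fill_def)
  qed
  show "fill A x $$ (j, i) = 1 / fill A x $$ (i, j)"
  proof (cases "A $$ (i, j)")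
    case None
    then have "i \<noteq> j"
      using D(3)[OF i] by auto
    then show ?thesis
      using None D(2) D(6)[OF i j None] i j by (auto simp: fill_def)
  next
    case (Some a)
    then show ?thesis
      using D(2) D(5)[OF i j Some] i j by (simp add: fill_def)
  qed
qed

lemma fill_carrier [simp]: "incomplete_pcm n A \<Longrightarrow> fill A x \<in> carrier_mat n n"
  by (auto simp: fill_def dest: incomplete_pcmD(1))

text \<open>Since \<open>ln \<lambda>\<^sub>m\<^sub>a\<^sub>x\<close> is convex in the logarithms of the entries, the first-order condition
  \<open>u\<^sub>i m\<^sub>i\<^sub>j v\<^sub>j = u\<^sub>j m\<^sub>j\<^sub>i v\<^sub>i\<close> at the missing positions, with \<open>u\<close> and \<open>v\<close> the left and right Perron
  vectors, is sufficient for optimality.\<close>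

theorem is_eigenvalue_completion_iff:
  assumes A: "incomplete_pcm n A" and conn: "connected_pcm A" and n: "n > 0"
    and x: "x \<in> missing A \<rightarrow>\<^sub>E {0<..}"
    and u: "positive_vec n u" and v: "positive_vec n v"
    and Mv: "fill A x *\<^sub>v v = a \<cdot>\<^sub>v v"
    and uM: "(fill A x)\<^sup>T *\<^sub>v u = a \<cdot>\<^sub>v u"
    and stationary: "\<And>i j. i < n \<Longrightarrow> j < n \<Longrightarrow> A $$ (i, j) = None \<Longrightarrow>
      u $ i * fill A x $$ (i, j) * v $ j = u $ j * fill A x $$ (j, i) * v $ i"
  shows "is_eigenvalue_completion A C \<longleftrightarrow> C = fill A x"
proof -
  note D = incomplete_pcmD[OF A]
  have carrier: "fill A y \<in> carrier_mat n n" for y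
    using A by simp
  have u': "u \<in> carrier_vec n" "\<And>i. i < n \<Longrightarrow> u $ i > 0"
    and v': "v \<in> carrier_vec n" "\<And>i. i < n \<Longrightarrow> v $ i > 0"
    using u v by (auto simp: positive_vec_def)
  have lam_x: "lambda_max (fill A x) = a"
    by (rule lambda_max_eqI[OF carrier n _ v Mv])
       (use fill_reciprocal(1)[OF A x] in \<open>auto intro: less_imp_le\<close>)
  have left: "(\<Sum>i\<in>{0..<n}. u $ i * fill A x $$ (i, j)) = a * u $ j" if j: "j < n" for j
    using eigenvector_coords[OF _ u'(1) uM j] carrier[of x] j
    by (simp add: mult.commute)
  have main: "a \<le> lambda_max (fill A y) \<and> (lambda_max (fill A y) = a \<longrightarrow> fill A y = fill A x)"
    if y: "y \<in> missing A \<rightarrow>\<^sub>E {0<..}" for y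
  proof -
    obtain b z where z: "positive_vec n z" and ev: "fill A y *\<^sub>v z = b \<cdot>\<^sub>v z"
      using Perron_exists[OF carrier n fill_reciprocal(1)[OF A y]] by blast
    have z': "z \<in> carrier_vec n" "\<And>i. i < n \<Longrightarrow> z $ i > 0"
      using z by (auto simp: positive_vec_def)
    have lam: "lambda_max (fill A y) = b"
      by (rule lambda_max_eqI[OF carrier n _ z ev])
         (use fill_reciprocal(1)[OF A y] in \<open>auto intro: less_imp_le\<close>)
    define h where "h i j = u $ i * fill A x $$ (i, j) * v $ j *
      ln (fill A y $$ (i, j) / fill A x $$ (i, j))" for i j
    \<comment> \<open>At a missing pair the weights are symmetric by \<open>stationary\<close> and
      the logarithms change sign with reciprocity; at a known pair the two fillings agree and the
      logarithm is 0. Antisymmetry makes the total vanish.\<close>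
    have anti: "h j i = - h i j" if i: "i < n" and j: "j < n" for i j
    proof (cases "A $$ (i, j)")
      case None
      note fx = fill_reciprocal[OF A x i j] and fy = fill_reciprocal[OF A y i j]
      have "ln (fill A y $$ (j, i) / fill A x $$ (j, i)) =
          - ln (fill A y $$ (i, j) / fill A x $$ (i, j))"
        unfolding fx(2) fy(2) using fx(1) fy(1) by (simp add: ln_div)
      then show ?thesis
        unfolding h_def stationary[OF i j None] by simp
    next
      case (Some c)
      have "fill A y $$ (k, l) = fill A x $$ (k, l)" if "(k, l) = (i, j) \<or> (k, l) = (j, i)" for k l
        using that Some D(2) D(5)[OF i j Some] i j by (auto simp: fill_def)
      then show ?thesis
        using fill_reciprocal(1)[OF A x] i j by (simp add: h_def)
    qed
    let ?S = "\<Sum>i\<in>{0..<n}. \<Sum>j\<in>{0..<n}. h i j"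
    have "?S = (\<Sum>i\<in>{0..<n}. \<Sum>j\<in>{0..<n}. h j i)"
      by (rule sum.swap)
    also have "\<dots> = - ?S"
      unfolding sum_negf[symmetric] by (intro sum.cong refl anti) simp_all
    finally have balance: "?S = 0" by simp
    note Perron = Perron_root_tangent[OF n, where M = "\<lambda>i j. fill A x $$ (i, j)"
        and N = "\<lambda>i j. fill A y $$ (i, j)" and u = "($) u" and v = "($) v" and z = "($) z"]
    note facts = fill_reciprocal(1)[OF A x] fill_reciprocal(1)[OF A y] u'(2) v'(2) z'(2)
      eigenvector_coords[OF carrier v'(1) Mv] left eigenvector_coords[OF carrier z'(1) ev]
      balance[unfolded h_def]
    have ab: "a \<le> b"
      by (rule Perron(1)) (assumption | rule facts)+
    have tight: "fill A y $$ (i, j) * z $ j * v $ i = fill A x $$ (i, j) * v $ j * z $ i"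
      if "a = b" "i < n" "j < n" for i j
      by (rule Perron(2)[OF _ _ _ _ _ _ _ _ _ that]) (assumption | rule facts)+
    have "fill A y = fill A x" if "b = a"
    proof -
      have eq: "fill A y $$ (i, j) * z $ j * v $ i = fill A x $$ (i, j) * v $ j * z $ i"
        if "i < n" "j < n" for i j
        using tight[OF \<open>b = a\<close>[symmetric] that] .
      \<comment> \<open>Where the fillings agree, tightness leaves only equality of the ratios
        \<open>z / v\<close>. Connectedness spreads this to all vertices, and tightness at the
        missing positions then forces equal entries there.\<close>
      have edge: "z $ i / v $ i = z $ j / v $ j" if "(i, j) \<in> pcm_edges A" for i j
      proof -
        from that obtain c where c: "i < n" "j < n" "A $$ (i, j) = Some c"
          using D(2) by (auto simp: pcm_edges_def known_def)
        then have "fill A y $$ (i, j) = c" "fill A x $$ (i, j) = c" "c > 0"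
          using D(2) D(4) by (auto simp: fill_def)
        then show ?thesis
          using eq[OF c(1,2)] v'(2)[OF c(1)] v'(2)[OF c(2)] by (simp add: field_simps)
      qed
      have walk: "z $ i / v $ i = z $ j / v $ j" if "(i, j) \<in> (pcm_edges A)\<^sup>*" for i j
        using that by induction (use edge in auto)
      show ?thesis
      proof (rule eq_matI)
        fix i j assume "i < dim_row (fill A x)" "j < dim_col (fill A x)"
        then have i: "i < n" and j: "j < n"
          using carrier[of x] by auto
        have "z $ i / v $ i = z $ j / v $ j"
          using conn i j D(2) walk by (simp add: connected_pcm_def)
        then have "z $ j * v $ i = v $ j * z $ i"
          using v'(2)[OF i] v'(2)[OF j] by (simp add: field_simps)
        then show "fill A y $$ (i, j) = fill A x $$ (i, j)"
          using eq[OF i j] v'(2)[OF j] z'(2)[OF i] by (simp add: mult.assoc)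
      qed (use carrier[of x] carrier[of y] in auto)
    qed
    then show ?thesis
      using ab lam by blast
  qed
  have min: "is_arg_min (\<lambda>y. lambda_max (fill A y)) (\<lambda>y. y \<in> missing A \<rightarrow>\<^sub>E {0<..}) x"
    unfolding is_arg_min_linorder lam_x using x main by blast
  have "fill A y = fill A x"
    if "is_arg_min (\<lambda>y. lambda_max (fill A y)) (\<lambda>y. y \<in> missing A \<rightarrow>\<^sub>E {0<..}) y" for y
  proof -
    have "y \<in> missing A \<rightarrow>\<^sub>E {0<..}" "lambda_max (fill A y) \<le> lambda_max (fill A x)"
      using that x unfolding is_arg_min_linorder by blast+
    then show ?thesis
      using main[of y] lam_x by (metis order_antisym)
  qed
  then show ?thesis
    using min unfolding is_eigenvalue_completion_def by blast
qed

section \<open>Least squares in logarithmic coordinates\<close>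

definition lls_residual :: "real option mat \<Rightarrow> real vec \<Rightarrow> nat \<Rightarrow> nat \<Rightarrow> real" where
  "lls_residual A w i j =
     (case A $$ (i, j) of None \<Rightarrow> 0 | Some a \<Rightarrow> ln a - ln (w $ i / w $ j))"

lemma sum_known:
  assumes "dim_row A = n"
  shows "(\<Sum>(i, j)\<in>known A. f i j) =
    (\<Sum>i\<in>{0..<n}. \<Sum>j\<in>{0..<n}. if A $$ (i, j) = None then 0 else f i j)"
  unfolding sum.cartesian_product
  by (rule sum.mono_neutral_cong_left) (use assms in \<open>auto simp: known_def split: if_splits\<close>)

text \<open>In the logarithms of the weights the objective is quadratic, so the second-order
  expansion is exact. Residuals are 0 at missing positions, which allows sums over the full square.
  The factor 4 is 2 from the square times 2 from antisymmetry of the residuals, each comparison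
  being counted in both orders.\<close>

lemma lls_objective_expand:
  assumes A: "incomplete_pcm n A" and w: "positive_vec n w" and w': "positive_vec n w'"
    and d: "\<And>i. i < n \<Longrightarrow> d i = ln (w' $ i) - ln (w $ i)"
  shows "lls_objective A w' = lls_objective A w
    - 4 * (\<Sum>i\<in>{0..<n}. d i * (\<Sum>j\<in>{0..<n}. lls_residual A w i j))
    + (\<Sum>(i, j)\<in>known A. (d i - d j)\<^sup>2)"
proof -
  note D = incomplete_pcmD[OF A]
  let ?r = "lls_residual A w"
  let ?S = "\<lambda>f. \<Sum>i\<in>{0..<n}. \<Sum>j\<in>{0..<n}. f i j"
  have wpos: "w $ i > 0" "w' $ i > 0" if "i < n" for i
    using w w' that by (auto simp: positive_vec_def)
  have anti: "?r j i = - ?r i j" if i: "i < n" and j: "j < n" for i j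
  proof (cases "A $$ (i, j)")
    case None
    then show ?thesis
      using D(6)[OF i j None] by (simp add: lls_residual_def)
  next
    case (Some a)
    then show ?thesis
      using D(4)[OF i j Some] D(5)[OF i j Some] wpos[OF i] wpos[OF j]
      by (simp add: lls_residual_def ln_div)
  qed
  have obj: "lls_objective A y = ?S (\<lambda>i j. (lls_residual A y i j)\<^sup>2)" for y
    unfolding lls_objective_def sum_known[OF D(2)]
    by (intro sum.cong refl) (auto simp: lls_residual_def)
  have "lls_objective A w' = ?S (\<lambda>i j. (?r i j)\<^sup>2 - (2 * (d i * ?r i j) - 2 * (d j * ?r i j))
      + (if A $$ (i, j) = None then 0 else (d i - d j)\<^sup>2))"
    unfolding obj
  proof (intro sum.cong refl)
    fix i j assume "i \<in> {0..<n}" "j \<in> {0..<n}"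
    then have i: "i < n" and j: "j < n" by auto
    show "(lls_residual A w' i j)\<^sup>2 = (?r i j)\<^sup>2 - (2 * (d i * ?r i j) - 2 * (d j * ?r i j))
      + (if A $$ (i, j) = None then 0 else (d i - d j)\<^sup>2)"
    proof (cases "A $$ (i, j)")
      case None
      then show ?thesis by (simp add: lls_residual_def)
    next
      case (Some a)
      then have eq: "lls_residual A w' i j = ?r i j - (d i - d j)"
        using wpos[OF i] wpos[OF j] by (simp add: lls_residual_def ln_div d[OF i] d[OF j])
      show ?thesis
        unfolding eq using Some by (simp add: power2_eq_square algebra_simps)
    qed
  qed
  also have "\<dots> = lls_objective A w - (2 * ?S (\<lambda>i j. d i * ?r i j) - 2 * ?S (\<lambda>i j. d j * ?r i j))
      + ?S (\<lambda>i j. if A $$ (i, j) = None then 0 else (d i - d j)\<^sup>2)"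
    unfolding obj by (simp only: sum.distrib sum_subtractf sum_distrib_left)
  also have "?S (\<lambda>i j. d j * ?r i j) = - ?S (\<lambda>i j. d i * ?r i j)"
  proof -
    have "?S (\<lambda>i j. d j * ?r i j) = ?S (\<lambda>i j. d i * ?r j i)"
      by (rule sum.swap)
    also have "\<dots> = ?S (\<lambda>i j. - (d i * ?r i j))"
    proof (intro sum.cong refl)
      fix i j assume "i \<in> {0..<n}" "j \<in> {0..<n}"
      then show "d i * ?r j i = - (d i * ?r i j)"
        by (subst anti) auto
    qed
    finally show ?thesis
      by (simp add: sum_negf)
  qed
  also have "?S (\<lambda>i j. if A $$ (i, j) = None then 0 else (d i - d j)\<^sup>2) =
      (\<Sum>(i, j)\<in>known A. (d i - d j)\<^sup>2)"
    by (rule sum_known[OF D(2), symmetric])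
  also have "?S (\<lambda>i j. d i * ?r i j) = (\<Sum>i\<in>{0..<n}. d i * (\<Sum>j\<in>{0..<n}. ?r i j))"
    by (simp only: sum_distrib_left)
  finally show ?thesis
    by simp
qed

theorem lls_normal_equations:
  assumes A: "incomplete_pcm n A"
  shows "is_arg_min (lls_objective A) (positive_vec n) w \<longleftrightarrow>
    positive_vec n w \<and> (\<forall>i<n. (\<Sum>j\<in>{0..<n}. lls_residual A w i j) = 0)"
proof (intro iffI conjI allI impI)
  assume min: "is_arg_min (lls_objective A) (positive_vec n) w"
  then show w: "positive_vec n w"
    unfolding is_arg_min_linorder by simp
  fix k assume k: "k < n"
  define R where "R = (\<Sum>j\<in>{0..<n}. lls_residual A w k j)"
  define e where "e i = (if i = k then 1 else 0 :: real)" for i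
  define Q where "Q = (\<Sum>(i, j)\<in>known A. (e i - e j)\<^sup>2)"
  have Q: "Q \<ge> 0"
    unfolding Q_def by (intro sum_nonneg) auto
  \<comment> \<open>A step short enough for the linear gain \<open>4 * (c * R)\<close> to outweigh
    the quadratic cost \<open>c\<^sup>2 * Q\<close> unless \<open>R\<close> is 0; the summand 1
    keeps the denominator positive when \<open>Q\<close> is 0.\<close>
  define c where "c = R / (Q + 1)"
  define w' where "w' = vec n (\<lambda>i. w $ i * exp (c * e i))"
  have w': "positive_vec n w'"
    using w by (auto simp: positive_vec_def w'_def)
  have "lls_objective A w' = lls_objective A w
    - 4 * (\<Sum>i\<in>{0..<n}. c * e i * (\<Sum>j\<in>{0..<n}. lls_residual A w i j))
    + (\<Sum>(i, j)\<in>known A. (c * e i - c * e j)\<^sup>2)"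
    by (rule lls_objective_expand[OF A w w'])
       (use w in \<open>auto simp: w'_def positive_vec_def ln_mult\<close>)
  also have "(\<Sum>i\<in>{0..<n}. c * e i * (\<Sum>j\<in>{0..<n}. lls_residual A w i j)) = c * R"
  proof -
    have "(\<Sum>i\<in>{0..<n}. c * e i * (\<Sum>j\<in>{0..<n}. lls_residual A w i j)) =
        (\<Sum>i\<in>{0..<n}. if i = k then c * R else 0)"
      by (intro sum.cong refl) (auto simp: e_def R_def)
    then show ?thesis
      using k by simp
  qed
  also have "(\<Sum>(i, j)\<in>known A. (c * e i - c * e j)\<^sup>2) = c\<^sup>2 * Q"
    unfolding Q_def sum_distrib_left
    by (intro sum.cong refl) (auto simp: right_diff_distrib[symmetric] power_mult_distrib)
  finally have "4 * (c * R) \<le> c\<^sup>2 * Q"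
    using min w' unfolding is_arg_min_linorder by (auto dest!: spec[of _ w'])
  moreover have "R = c * (Q + 1)"
    using Q by (simp add: c_def)
  ultimately have "c\<^sup>2 * (3 * Q + 4) \<le> 0"
    by (simp add: power2_eq_square algebra_simps)
  then have "c = 0"
    using Q by (simp add: mult_le_0_iff)
  then show "R = 0"
    using \<open>R = c * (Q + 1)\<close> by simp
next
  assume w: "positive_vec n w \<and> (\<forall>i<n. (\<Sum>j\<in>{0..<n}. lls_residual A w i j) = 0)"
  show "is_arg_min (lls_objective A) (positive_vec n) w"
    unfolding is_arg_min_linorder
  proof (intro conjI allI impI)
    fix w' assume w': "positive_vec n w'"
    define d where "d i = ln (w' $ i) - ln (w $ i)" for i
    have "lls_objective A w' = lls_objective A w + (\<Sum>(i, j)\<in>known A. (d i - d j)\<^sup>2)"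
      using w lls_objective_expand[OF A _ w', of w d] by (simp add: d_def)
    moreover have "(\<Sum>(i, j)\<in>known A. (d i - d j)\<^sup>2) \<ge> 0"
      by (intro sum_nonneg) auto
    ultimately show "lls_objective A w \<le> lls_objective A w'" by simp
  qed (use w in simp)
qed

section \<open>A matrix with one missing entry\<close>

text \<open>The entries have the form \<open>exp (arsinh s)\<close> where the \<open>s\<close> form an antisymmetric matrix with zero
  row sums, so that corresponding row and column sums agree; \<open>valP, valQ, valR, valF\<close> correspond to
  \<open>s = c, d, c + d, 2 c - d\<close> with \<open>c = 3 / 4\<close>, and \<open>d\<close> is chosen to make all row sums equal. As
  \<open>arsinh\<close> is not additive, the row products need not be \<open>1\<close>.\<close>

definition valP :: real where "valP = 2"

definition valR :: real where "valR = (5 + 3 * sqrt 5) / 4"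

definition valF :: real where "valF = 1 + 3 * sqrt 5 / 5"

definition valQ :: real where
  "valQ = (let d = 3 / 8 + 3 * sqrt 5 / 40 in d + sqrt (1 + d\<^sup>2))"

lemma val_pos: "valP > 0" "valR > 0" "valF > 0" "valQ > 0"
  by (simp_all add: valP_def valR_def valF_def valQ_def Let_def add_pos_pos add_pos_nonneg)

text \<open>With these forms every row and column sum of the block becomes linear in
  \<open>sqrt 5\<close> and \<open>valQ\<close>. They come from exp (- arsinh s) = exp (arsinh s) -
  2 s.\<close>

lemma inverse_val:
  shows "1 / valR = 3 * sqrt 5 / 5 - 1" "1 / valF = 3 * sqrt 5 / 4 - 5 / 4"
    "1 / valQ = valQ - (3 / 4 + 3 * sqrt 5 / 20)"
proof -
  have s: "sqrt 5 * sqrt 5 = (5 :: real)" by simp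
  have "valR * (3 * sqrt 5 / 5 - 1) = 1" "valF * (3 * sqrt 5 / 4 - 5 / 4) = 1"
    using s by (simp_all add: valR_def valF_def field_simps)
  then show "1 / valR = 3 * sqrt 5 / 5 - 1" "1 / valF = 3 * sqrt 5 / 4 - 5 / 4"
    using val_pos by (simp_all add: field_simps)
  define d :: real where "d = 3 / 8 + 3 * sqrt 5 / 40"
  have "(d + sqrt (1 + d\<^sup>2)) * (sqrt (1 + d\<^sup>2) - d) = (sqrt (1 + d\<^sup>2))\<^sup>2 - d\<^sup>2"
    by (simp add: power2_eq_square algebra_simps)
  also have "\<dots> = 1"
    by (subst real_sqrt_pow2) auto
  finally have "valQ * (valQ - 2 * d) = 1"
    unfolding valQ_def Let_def d_def[symmetric] by (simp add: algebra_simps)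
  then show "1 / valQ = valQ - (3 / 4 + 3 * sqrt 5 / 20)"
    using val_pos(4) by (simp add: d_def field_simps)
qed

text \<open>Equality would mean arsinh c + arsinh d = arsinh (c + d). Comparing the two expressions
  for \<open>1 / valQ\<close> then makes \<open>sqrt 5\<close> equal to the rational number 25 /
  13.\<close>

lemma valP_valQ_neq_valR: "valP * valQ \<noteq> valR"
proof
  assume "valP * valQ = valR"
  then have Q: "valQ = valR / 2" by (simp add: valP_def)
  have "1 / valQ = 2 * (1 / valR)" by (simp add: Q)
  then have "2 * (3 * sqrt 5 / 5 - 1) = (5 + 3 * sqrt 5) / 8 - (3 / 4 + 3 * sqrt 5 / 20)"
    unfolding inverse_val by (simp add: Q valR_def)
  then have "sqrt 5 = 25 / 13"
    by (simp add: field_simps)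
  then have "5 = (25 / 13 * (25 / 13) :: real)"
    using real_sqrt_mult_self[of 5] by (simp only: abs_numeral)
  then show False
    by simp
qed

text \<open>In rows 0 to 3 the parameters s are c, d and -(c + d) up to a common sign; in rows 4 and
  5 they are -c, -c, d and 2 c - d, again up to sign. Each row adds up to 0, so its sum is that of
  the terms sqrt (1 + s^2). Equality of all rows thus reads 1 + sqrt (1 + (c + d)^2) = sqrt (1 +
  c^2) + sqrt (1 + (2 c - d)^2). For c = 3 / 4 two squarings give 80 d^2 - 60 d + 9 = 0, whose
  larger root is d = 3 / 8 + 3 sqrt 5 / 40.\<close>

definition core :: "real list list" where
  "core =
    [[1       , 1       , 1       , 1 / valR, valP    , valQ],
     [1       , 1       , valR    , 1       , 1 / valQ, 1 / valP],
     [1       , 1 / valR, 1       , valQ    , valP    , 1],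
     [valR    , 1       , 1 / valQ, 1       , 1       , 1 / valP],
     [1 / valP, valQ    , 1 / valP, 1       , 1       , valF],
     [1 / valQ, valP    , 1       , valP    , 1 / valF, 1]]"

definition core_sum :: real where "core_sum = 3 + valP + valQ + 1 / valR"

definition entry :: "nat \<Rightarrow> nat \<Rightarrow> real" where
  "entry i j = (if i < 6 \<and> j < 6 then core ! i ! j else 1)"

lemma less_6_cases:
  assumes "(i :: nat) < 6"
  obtains "i = 0" | "i = 1" | "i = 2" | "i = 3" | "i = 4" | "i = 5"
  using assms by linarith

lemma sum_6: "(\<Sum>j\<in>{0..<6}. f j) = f 0 + f 1 + f 2 + f 3 + f 4 + (f (5 :: nat) :: real)"
  by (simp add: eval_nat_numeral)

lemma entry_pos: "entry i j > 0"
proof (cases "i < 6 \<and> j < 6")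
  case True
  then show ?thesis
    using val_pos
    by (elim conjE; elim less_6_cases) (simp_all add: entry_def core_def)
qed (auto simp: entry_def)

lemma entry_reciprocal: "entry j i = 1 / entry i j"
proof (cases "i < 6 \<and> j < 6")
  case True
  then show ?thesis
    by (elim conjE; elim less_6_cases) (simp_all add: entry_def core_def)
qed (auto simp: entry_def)

lemma entry_diag: "entry i i = 1"
proof (cases "i < 6")
  case True
  then show ?thesis
    by (elim less_6_cases) (simp_all add: entry_def core_def)
qed (auto simp: entry_def)

lemma entry_row_sum:
  assumes "i < 6"
  shows "(\<Sum>j\<in>{0..<6}. entry i j) = core_sum"
  using assms
  by (elim less_6_cases; simp add: sum_6 entry_def core_def core_sum_def inverse_val valP_def)
    (simp_all add: valR_def valF_def field_simps)

lemma entry_col_sum: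
  assumes "j < 6"
  shows "(\<Sum>i\<in>{0..<6}. entry i j) = core_sum"
  using assms
  by (elim less_6_cases; simp add: sum_6 entry_def core_def core_sum_def inverse_val valP_def)
    (simp_all add: valR_def valF_def field_simps)

section \<open>The incomplete matrix and its eigenvalue completion\<close>

definition gap_pcm :: "nat \<Rightarrow> real option mat" where
  "gap_pcm n = mat n n (\<lambda>(i, j). if {i, j} = {0, 1} then None else Some (entry i j))"

lemma gap_pcm_index:
  "i < n \<Longrightarrow> j < n \<Longrightarrow> gap_pcm n $$ (i, j) = (if {i, j} = {0, 1} then None else Some (entry i j))"
  by (simp add: gap_pcm_def)

lemma incomplete_gap_pcm: "incomplete_pcm n (gap_pcm n)"
  unfolding incomplete_pcm_def
proof (intro conjI allI impI)
  show "gap_pcm n \<in> carrier_mat n n"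
    by (simp add: gap_pcm_def)
next
  fix i assume "i < n"
  then show "gap_pcm n $$ (i, i) = Some 1"
    by (auto simp: gap_pcm_index entry_diag doubleton_eq_iff)
next
  fix i j a assume "i < n" "j < n" "gap_pcm n $$ (i, j) = Some a"
  then show "0 < a" "gap_pcm n $$ (j, i) = Some (1 / a)"
    by (auto simp: gap_pcm_index entry_pos entry_reciprocal[of j i] insert_commute split: if_splits)
next
  fix i j assume "i < n" "j < n" "gap_pcm n $$ (i, j) = None"
  then show "gap_pcm n $$ (j, i) = None"
    by (auto simp: gap_pcm_index insert_commute split: if_splits)
qed

text \<open>Vertex 2 lies outside the only missing pair and is adjacent to every other
  vertex.\<close>

lemma connected_gap_pcm:
  assumes "n > 2"
  shows "connected_pcm (gap_pcm n)"
proof -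
  have dim: "dim_row (gap_pcm n) = n"
    by (simp add: gap_pcm_def)
  have "(i, 2) \<in> (pcm_edges (gap_pcm n))\<^sup>*" "(2, i) \<in> (pcm_edges (gap_pcm n))\<^sup>*" if "i < n" for i
    using that assms
    by (cases "i = 2"; force simp: pcm_edges_def known_def dim gap_pcm_index doubleton_eq_iff)+
  then show ?thesis
    unfolding connected_pcm_def dim by (meson rtrancl_trans)
qed

lemma missing_gap_pcm: "n > 1 \<Longrightarrow> missing (gap_pcm n) = {(0, 1)}"
  by (auto simp: missing_def gap_pcm_def doubleton_eq_iff split: if_splits)

lemma entry_01: "{i, j} = {0, 1} \<Longrightarrow> entry i j = 1"
  by (auto simp: doubleton_eq_iff entry_def core_def)

lemma fill_gap_pcm:
  assumes "n > 1"
  shows "fill (gap_pcm n) (\<lambda>e\<in>missing (gap_pcm n). 1) = mat n n (\<lambda>(i, j). entry i j)"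
proof (rule eq_matI)
  fix i j assume "i < dim_row (mat n n (\<lambda>(i, j). entry i j))"
    "j < dim_col (mat n n (\<lambda>(i, j). entry i j))"
  then have ij: "i < n" "j < n" by auto
  show "fill (gap_pcm n) (\<lambda>e\<in>missing (gap_pcm n). 1) $$ (i, j) = mat n n (\<lambda>(i, j). entry i j) $$ (i, j)"
    using ij assms entry_01[of i j] unfolding missing_gap_pcm[OF assms]
    by (auto simp: fill_def gap_pcm_def doubleton_eq_iff)
qed (auto simp: fill_def gap_pcm_def)

lemma gap_eigenvalue_completion:
  assumes n: "n > 5"
  shows "is_eigenvalue_completion (gap_pcm n) C \<longleftrightarrow> C = mat n n (\<lambda>(i, j). entry i j)"
proof -
  define e where "e = real (n - 6)"
  \<comment> \<open>On vectors constant on the two blocks, the matrix acts as the quotient matrix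
    with rows (\<open>core_sum\<close>, \<open>e\<close>) and (6, \<open>e\<close>).
    \<open>D\<close> is the root of its discriminant, \<open>a\<close> its larger eigenvalue and
    (\<open>a - e\<close>, 6) an eigenvector.\<close>
  define D where "D = sqrt ((core_sum - e)\<^sup>2 + 24 * e)"
  define a where "a = (core_sum + e + D) / 2"
  define v where "v = vec n (\<lambda>i. if i < 6 then a - e else 6)"
  have e: "e \<ge> 0" by (simp add: e_def)
  have s: "core_sum > 0"
    using val_pos by (simp add: core_sum_def add_pos_pos)
  have D2: "D\<^sup>2 = (core_sum - e)\<^sup>2 + 24 * e"
    unfolding D_def using e by (intro real_sqrt_pow2) auto
  have aq: "(a - core_sum) * (a - e) = 6 * e"
    using D2 by (simp add: a_def power2_eq_square field_simps)
  have "D \<ge> \<bar>core_sum - e\<bar>"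
    unfolding D_def using e by (intro real_le_rsqrt) auto
  \<comment> \<open>Strictness makes \<open>v\<close> positive. Equality could hold only for
    \<open>e = 0\<close>, that is for order 6, where \<open>core_sum > 0\<close> rules it
    out.\<close>
  moreover have "D \<noteq> e - core_sum"
  proof
    assume "D = e - core_sum"
    then have "24 * e = 0"
      using D2 by (simp add: power2_commute)
    then show False
      using \<open>D \<ge> \<bar>core_sum - e\<bar>\<close> \<open>D = e - core_sum\<close> s by simp
  qed
  ultimately have ae: "a - e > 0"
    by (simp add: a_def field_simps)
  have v: "positive_vec n v"
    using ae by (auto simp: positive_vec_def v_def)
  have split: "(\<Sum>j\<in>{0..<n}. f j * v $ j) = (a - e) * (\<Sum>j\<in>{0..<6}. f j) + 6 * (\<Sum>j\<in>{6..<n}. f j)"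
    for f
  proof -
    have "(\<Sum>j\<in>{0..<n}. f j * v $ j) = (\<Sum>j\<in>{0..<6}. f j * v $ j) + (\<Sum>j\<in>{6..<n}. f j * v $ j)"
      using n by (intro sum.atLeastLessThan_concat[symmetric]) auto
    also have "(\<Sum>j\<in>{0..<6}. f j * v $ j) = (a - e) * (\<Sum>j\<in>{0..<6}. f j)"
      using n unfolding sum_distrib_left by (intro sum.cong) (auto simp: v_def)
    also have "(\<Sum>j\<in>{6..<n}. f j * v $ j) = 6 * (\<Sum>j\<in>{6..<n}. f j)"
      unfolding sum_distrib_left by (intro sum.cong) (auto simp: v_def)
    finally show ?thesis .
  qed
  \<comment> \<open>The line \<open>f\<close> is arbitrary so that rows and columns are treated at
    once, giving the right and the left eigenvector.\<close>
  have eig: "(\<Sum>j\<in>{0..<n}. f j * v $ j) = a * v $ i"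
    if i: "i < n" and core: "i < 6 \<Longrightarrow> (\<Sum>j\<in>{0..<6}. f j) = core_sum"
      and one: "\<And>j. \<not> (i < 6 \<and> j < 6) \<Longrightarrow> f j = 1" for f i
  proof -
    have "(\<Sum>j\<in>{6..<n}. f j) = e"
      using one by (simp add: e_def)
    moreover have "(\<Sum>j\<in>{0..<6}. f j) = (if i < 6 then core_sum else 6)"
      using core one by simp
    ultimately show ?thesis
      unfolding split using aq i by (simp add: v_def algebra_simps)
  qed
  let ?M = "mat n n (\<lambda>(i, j). entry i j)"
  let ?x = "\<lambda>e\<in>missing (gap_pcm n). 1 :: real"
  have M: "fill (gap_pcm n) ?x = ?M"
    using n by (intro fill_gap_pcm) auto
  have vc: "v \<in> carrier_vec n"
    by (simp add: v_def)
  have "is_eigenvalue_completion (gap_pcm n) C \<longleftrightarrow> C = fill (gap_pcm n) ?x"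
  proof (rule is_eigenvalue_completion_iff[OF incomplete_gap_pcm _ _ _ v v])
    show "connected_pcm (gap_pcm n)"
      using n by (intro connected_gap_pcm) auto
    show "fill (gap_pcm n) ?x *\<^sub>v v = a \<cdot>\<^sub>v v"
      unfolding M
    proof (rule eigenvectorI_coords[OF _ vc])
      fix i assume i: "i < n"
      have "(\<Sum>j\<in>{0..<n}. ?M $$ (i, j) * v $ j) = (\<Sum>j\<in>{0..<n}. entry i j * v $ j)"
        using i by (intro sum.cong) auto
      also have "\<dots> = a * v $ i"
        by (rule eig[OF i entry_row_sum]) (auto simp: entry_def)
      finally show "(\<Sum>j\<in>{0..<n}. ?M $$ (i, j) * v $ j) = a * v $ i" .
    qed simp
    show "(fill (gap_pcm n) ?x)\<^sup>T *\<^sub>v v = a \<cdot>\<^sub>v v"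
      unfolding M
    proof (rule eigenvectorI_coords[OF _ vc])
      fix i assume i: "i < n"
      have "(\<Sum>j\<in>{0..<n}. ?M\<^sup>T $$ (i, j) * v $ j) = (\<Sum>j\<in>{0..<n}. entry j i * v $ j)"
        using i by (intro sum.cong) auto
      also have "\<dots> = a * v $ i"
        by (rule eig[OF i entry_col_sum]) (auto simp: entry_def)
      finally show "(\<Sum>j\<in>{0..<n}. ?M\<^sup>T $$ (i, j) * v $ j) = a * v $ i" .
    qed simp
    fix i j assume "i < n" "j < n" "gap_pcm n $$ (i, j) = None"
    then have "{i, j} = {0, 1}"
      by (auto simp: gap_pcm_index split: if_splits)
    then show "v $ i * fill (gap_pcm n) ?x $$ (i, j) * v $ j =
        v $ j * fill (gap_pcm n) ?x $$ (j, i) * v $ i"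
      unfolding M using \<open>i < n\<close> \<open>j < n\<close> entry_01[of i j] entry_01[of j i]
      by (simp add: insert_commute)
  qed (use n in auto)
  then show ?thesis
    unfolding M .
qed

section \<open>The least squares completion\<close>

definition log_sum :: "nat \<Rightarrow> nat \<Rightarrow> real" where
  "log_sum n i = (\<Sum>j\<in>{0..<n}. ln (entry i j))"

lemma log_sum_01:
  assumes "n > 5"
  shows "log_sum n 0 = ln (valP * valQ / valR)" "log_sum n 1 = - ln (valP * valQ / valR)"
proof -
  have split: "log_sum n i = (\<Sum>j\<in>{0..<6}. ln (entry i j))" for i
  proof -
    have "log_sum n i = (\<Sum>j\<in>{0..<6}. ln (entry i j)) + (\<Sum>j\<in>{6..<n}. ln (entry i j))"
      unfolding log_sum_def using assms by (intro sum.atLeastLessThan_concat[symmetric]) auto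
    then show ?thesis
      by (simp add: entry_def)
  qed
  show "log_sum n 0 = ln (valP * valQ / valR)" "log_sum n 1 = - ln (valP * valQ / valR)"
    unfolding split sum_6 using val_pos
    by (simp_all add: entry_def core_def ln_div ln_mult)
qed

lemma sum_log_sum: "(\<Sum>i\<in>{0..<n}. log_sum n i) = 0"
proof -
  have "(\<Sum>i\<in>{0..<n}. log_sum n i) = (\<Sum>i\<in>{0..<n}. \<Sum>j\<in>{0..<n}. ln (entry j i))"
    unfolding log_sum_def by (rule sum.swap)
  also have "\<dots> = (\<Sum>i\<in>{0..<n}. - log_sum n i)"
    unfolding log_sum_def sum_negf[symmetric]
  proof (intro sum.cong refl)
    fix i j
    show "ln (entry j i) = - ln (entry i j)"
      unfolding entry_reciprocal[of j i] using entry_pos[of i j] by (simp add: ln_div)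
  qed
  finally show ?thesis
    by (simp add: sum_negf)
qed

text \<open>The missing pair contributes \<open>ln 1 = 0\<close> to \<open>log_sum\<close>, which explains the correction term.\<close>

lemma gap_residual_sum:
  assumes w: "positive_vec n w" and n: "n > 1" and i: "i < n"
  shows "(\<Sum>j\<in>{0..<n}. lls_residual (gap_pcm n) w i j) =
    log_sum n i - real n * ln (w $ i) + (\<Sum>j\<in>{0..<n}. ln (w $ j))
      + (if i = 0 then ln (w $ 0) - ln (w $ 1)
         else if i = 1 then ln (w $ 1) - ln (w $ 0) else 0)"
proof -
  have wpos: "w $ j > 0" if "j < n" for j
    using w that by (auto simp: positive_vec_def)
  have "(\<Sum>j\<in>{0..<n}. lls_residual (gap_pcm n) w i j) =
    (\<Sum>j\<in>{0..<n}. ln (entry i j) - ln (w $ i) + ln (w $ j)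
      + (if {i, j} = {0, 1} then ln (w $ i) - ln (w $ j) else 0))"
  proof (rule sum.cong[OF refl])
    fix j assume "j \<in> {0..<n}"
    then have j: "j < n" by simp
    show "lls_residual (gap_pcm n) w i j = ln (entry i j) - ln (w $ i) + ln (w $ j)
      + (if {i, j} = {0, 1} then ln (w $ i) - ln (w $ j) else 0)"
    proof (cases "{i, j} = {0, 1}")
      case True
      then show ?thesis
        using i j entry_01[OF True] by (simp add: lls_residual_def gap_pcm_index)
    next
      case False
      then show ?thesis
        using i j wpos[OF i] wpos[OF j] by (simp add: lls_residual_def gap_pcm_index ln_div)
    qed
  qed
  also have "\<dots> = log_sum n i - real n * ln (w $ i) + (\<Sum>j\<in>{0..<n}. ln (w $ j))
      + (\<Sum>j\<in>{0..<n}. if {i, j} = {0, 1} then ln (w $ i) - ln (w $ j) else 0)"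
    by (simp add: sum.distrib sum_subtractf log_sum_def)
  \<comment> \<open>Subtraction is truncated: \<open>1 - i\<close> exchanges 0 and 1, and for larger
    \<open>i\<close> it points to 0, where the inner conditional is 0 anyway.\<close>
  also have "(\<Sum>j\<in>{0..<n}. if {i, j} = {0, 1} then ln (w $ i) - ln (w $ j) else 0) =
    (\<Sum>j\<in>{0..<n}. if j = 1 - i then
      (if i = 0 then ln (w $ 0) - ln (w $ 1)
       else if i = 1 then ln (w $ 1) - ln (w $ 0) else 0) else 0)"
    by (intro sum.cong refl) (auto simp: doubleton_eq_iff)
  also have "\<dots> = (if i = 0 then ln (w $ 0) - ln (w $ 1)
       else if i = 1 then ln (w $ 1) - ln (w $ 0) else 0)"
    using n by (subst sum.delta) auto
  finally show ?thesis .
qed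

lemma gap_lls_exists:
  assumes n: "n > 5"
  shows "\<exists>B. is_lls_completion (gap_pcm n) B"
proof -
  define t where "t = log_sum n 0"
  have t1: "log_sum n 1 = - t"
    using log_sum_01[OF n] by (simp add: t_def)
  \<comment> \<open>Solution of the normal equations normalised to sum 0. From row 2 on they read
    \<open>real n * W i = log_sum n i\<close>; in rows 0 and 1 the correction term and
    \<open>W 1 = - W 0\<close> turn the factor \<open>n\<close> into \<open>n - 2\<close>.\<close>
  define W where "W i = (if i = 0 then t / (real n - 2) else if i = 1 then - t / (real n - 2)
    else log_sum n i / real n)" for i
  define w where "w = vec n (\<lambda>i. exp (W i))"
  have w: "positive_vec n w"
    by (auto simp: positive_vec_def w_def)
  have lw: "ln (w $ i) = W i" if "i < n" for i
    using that by (simp add: w_def)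
  have head: "(\<Sum>i\<in>{0..<n}. f i) = f 0 + f 1 + (\<Sum>i\<in>{2..<n}. f i)" for f :: "nat \<Rightarrow> real"
    using n by (simp add: sum.atLeast_Suc_lessThan numeral_2_eq_2)
  have "(\<Sum>i\<in>{2..<n}. log_sum n i) = 0"
    using sum_log_sum[of n] t1 unfolding head by (simp add: t_def)
  then have "(\<Sum>i\<in>{2..<n}. W i) = 0"
    by (simp add: W_def sum_divide_distrib[symmetric])
  then have "(\<Sum>i\<in>{0..<n}. W i) = 0"
    unfolding head by (simp add: W_def)
  then have sum0: "(\<Sum>i\<in>{0..<n}. ln (w $ i)) = 0"
    by (simp add: lw)
  have "is_arg_min (lls_objective (gap_pcm n)) (positive_vec n) w"
    unfolding lls_normal_equations[OF incomplete_gap_pcm]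
  proof (intro conjI allI impI w)
    fix i assume i: "i < n"
    show "(\<Sum>j\<in>{0..<n}. lls_residual (gap_pcm n) w i j) = 0"
    proof -
      have res: "(\<Sum>j\<in>{0..<n}. lls_residual (gap_pcm n) w i j) =
          log_sum n i - real n * W i
            + (if i = 0 then W 0 - W 1 else if i = 1 then W 1 - W 0 else 0)"
        using gap_residual_sum[OF w _ i] n sum0 by (simp add: lw i)
      have "real n * W 0 = t + 2 * W 0" "W 1 = - W 0"
        using n by (simp_all add: W_def field_simps)
      moreover have "real n * W i = log_sum n i" if "i \<noteq> 0" "i \<noteq> 1"
        using n that by (simp add: W_def)
      ultimately show ?thesis
        unfolding res using t1 by (auto simp: t_def[symmetric])
    qed
  qed
  then have "is_arg_min (lls_objective (gap_pcm n)) (positive_vec (dim_row (gap_pcm n))) w"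
    by (simp add: gap_pcm_def)
  then show ?thesis
    unfolding is_lls_completion_def by blast
qed

text \<open>The value 1 would mean equal weights at 0 and 1. The correction terms then vanish and
  the two normal equations give equal log sums; as these are opposite numbers, both would be 0,
  contrary to \<open>valP_valQ_neq_valR\<close>.\<close>

lemma gap_lls_completion_01:
  assumes n: "n > 5" and B: "is_lls_completion (gap_pcm n) B"
  shows "B $$ (0, 1) \<noteq> 1"
proof
  assume one: "B $$ (0, 1) = 1"
  have dim: "dim_row (gap_pcm n) = n"
    by (simp add: gap_pcm_def)
  obtain w where min: "is_arg_min (lls_objective (gap_pcm n)) (positive_vec n) w"
    and Bw: "B = mat n n (\<lambda>(i, j). case gap_pcm n $$ (i, j) of Some a \<Rightarrow> a | None \<Rightarrow> w $ i / w $ j)"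
    using B unfolding is_lls_completion_def dim by blast
  have w: "positive_vec n w"
    and normal: "\<And>i. i < n \<Longrightarrow> (\<Sum>j\<in>{0..<n}. lls_residual (gap_pcm n) w i j) = 0"
    using min unfolding lls_normal_equations[OF incomplete_gap_pcm] by auto
  have "w $ 0 / w $ 1 = 1" "w $ 1 > 0"
    using one n w by (auto simp: Bw gap_pcm_index positive_vec_def)
  then have "w $ 0 = w $ 1"
    by simp
  then have "log_sum n 0 = log_sum n 1"
    using normal[of 0] normal[of 1] gap_residual_sum[OF w, of 0] gap_residual_sum[OF w, of 1] n
    by simp
  then have "ln (valP * valQ / valR) = 0"
    unfolding log_sum_01[OF n] by simp
  moreover have "valP * valQ / valR > 0"
    using val_pos by simp
  ultimately have "valP * valQ / valR = 1"
    using ln_eq_zero_iff by blast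
  then show False
    using valP_valQ_neq_valR val_pos(2) by (simp add: divide_simps)
qed

theorem mainTheorem3:
  fixes n :: nat
  assumes "n > 5"
  shows "\<exists>A. incomplete_pcm n A \<and> connected_pcm A \<and>
           (\<exists>B. is_lls_completion A B) \<and> (\<exists>C. is_eigenvalue_completion A C) \<and>
           (\<forall>B C. is_lls_completion A B \<longrightarrow> is_eigenvalue_completion A C \<longrightarrow> B \<noteq> C)"
proof (intro exI[of _ "gap_pcm n"] conjI allI impI)
  show "incomplete_pcm n (gap_pcm n)"
    by (rule incomplete_gap_pcm)
  show "connected_pcm (gap_pcm n)"
    using assms by (intro connected_gap_pcm) auto
  show "\<exists>B. is_lls_completion (gap_pcm n) B"
    by (rule gap_lls_exists[OF assms])
  show "\<exists>C. is_eigenvalue_completion (gap_pcm n) C"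
    unfolding gap_eigenvalue_completion[OF assms] by blast
  fix B C
  assume B: "is_lls_completion (gap_pcm n) B" and "is_eigenvalue_completion (gap_pcm n) C"
  then have "C $$ (0, 1) = 1"
    using assms entry_01[of 0 1] by (simp add: gap_eigenvalue_completion)
  then show "B \<noteq> C"
    using gap_lls_completion_01[OF assms B] by blast
qed

end
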